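(* Let $Q$ be a quaternion division algebra over a field $F$. Let $M=\begin{bmatrix} A & B\\ C & D\end{bmatrix}\in M_4(Q)$, where $A,B,C,D\in M_2(Q)$ and $C$ is invertible. For $\lambda\in Q$ define $e(\lambda),f(\lambda),g(\lambda),h(\lambda)\in Q$ by $$C(A-\lambda I)C^{-1}(D-\lambda I)-CB=\begin{bmatrix} e(\lambda) & f(\lambda)\\ g(\lambda) & h(\lambda)\end{bmatrix}.$$ Then $\lambda\in Q$ is a left eigenvalue of $M$ if and only if either $e(\lambda)=f(\lambda)g(\lambda)=0$, or $e(\lambda)\neq 0$ and $e(\lambda)\overline{e(\lambda)}\,h(\lambda)-g(\lambda)\overline{e(\lambda)}f(\lambda)=0$.
   Context: A left eigenvalue of a matrix $M\in M_n(Q)$ is an element $\lambda\in Q$ for which there exists a nonzero column vector $v\in Q^{n\times 1}$ with $Mv=\lambda v$. Here $\lambda I$ is the diagonal matrix with all diagonal entries $\lambda$, and $q\mapsto\overline{q}$ denotes the canonical (standard) conjugation of the quaternion algebra $Q$, so that $q\overline{q}=\overline{q}q\in F$ is the reduced norm of $q$. *)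

theory Defs
  imports "HOL-Analysis.Analysis"
begin

definition left_eigenvalue :: "'a::semiring_1 ^ 'n ^ 'n \<Rightarrow> 'a \<Rightarrow> bool" where
  "left_eigenvalue M l \<longleftrightarrow> (\<exists>v. v \<noteq> 0 \<and> M *v v = l *s v)"

definition block_matrix ::
    "'a::zero ^ 2 ^ 2 \<Rightarrow> 'a ^ 2 ^ 2 \<Rightarrow> 'a ^ 2 ^ 2 \<Rightarrow> 'a ^ 2 ^ 2 \<Rightarrow> 'a ^ 4 ^ 4" where
  "block_matrix A B C D =
     vector [vector [A$1$1, A$1$2, B$1$1, B$1$2],
             vector [A$2$1, A$2$2, B$2$1, B$2$2],
             vector [C$1$1, C$1$2, D$1$1, D$1$2],
             vector [C$2$1, C$2$2, D$2$1, D$2$2]]"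

(* A quaternion algebra over a field of arbitrary characteristic, given by a standard presentation:
     i^2 = a,      j^2 = b,  j i = - i j      if the characteristic is not 2,
     i^2 + i = a,  j^2 = b,  j i = (i + 1) j  if the characteristic is 2,
   with F-basis 1, i, j, ij.  The map scale is the F-algebra structure; that the algebra is a
   division algebra is expressed by the class of 'q. *)
locale quaternion_division_algebra = vector_space scale
  for scale :: "'f::field \<Rightarrow> 'q::division_ring \<Rightarrow> 'q" +
  fixes a b :: 'f and i j :: 'q
  assumes scale_mult_left: "scale r x * y = scale r (x * y)"
    and scale_mult_right: "x * scale r y = scale r (x * y)"
    and distinct_basis: "distinct [1, i, j, i * j]"
    and independent_basis: "independent {1, i, j, i * j}"
    and span_basis: "span {1, i, j, i * j} = UNIV"
    and b_nonzero: "b \<noteq> 0"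
    and j_square: "j * j = scale b 1"
    and char_not_2: "(2::'f) \<noteq> 0 \<Longrightarrow> a \<noteq> 0 \<and> i * i = scale a 1 \<and> j * i = - (i * j)"
    and char_2: "(2::'f) = 0 \<Longrightarrow> i * i + i = scale a 1 \<and> j * i = (i + 1) * j"
begin

(* The canonical conjugation: x + y i + z j + w ij is sent to x - y i - z j - w ij if the
   characteristic is not 2, and to x + y (i + 1) + z j + w ij if it is 2 (where - z = z). *)
definition conjugate :: "'q \<Rightarrow> 'q" where
  "conjugate q =
     (let c = representation {1, i, j, i * j} q in
        scale (c 1) 1 + scale (c i) (if (2::'f) = 0 then i + 1 else - i)
        - scale (c j) j - scale (c (i * j)) (i * j))"

end

end

theory Submission
  imports Defs
begin

text \<open>
  Eliminating the first half of a null vector of \<open>M - l I\<close> with the invertible block \<open>C\<close> turns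
  singularity of \<open>M - l I\<close> into singularity of the 2 by 2 matrix with rows \<open>(e, f)\<close> and \<open>(g, h)\<close>.
  If \<open>e\<close> is nonzero, that matrix is singular iff the Schur complement \<open>h - g e\<^sup>-\<^sup>1 f\<close> vanishes; as the
  reduced norm of \<open>e\<close> is central and nonzero, multiplying by it clears the inverse.
\<close>

context quaternion_division_algebra
begin

section \<open>Multiplication tables of the basis in the two characteristic cases\<close>

lemma basis_products_char_not_2:
  assumes "(2::'f) \<noteq> 0"
  shows "i * i = scale a 1" "j * i = - (i * j)" "j * j = scale b 1"
    "i * (i * j) = scale a j" "i * j * i = - scale a j"
    "i * j * j = scale b i" "j * (i * j) = - scale b i"
    "i * j * (i * j) = - scale (a * b) 1"
proof -
  show ii: "i * i = scale a 1" and ji: "j * i = - (i * j)" and jj: "j * j = scale b 1"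
    using char_not_2[OF assms] j_square by auto
  show iij: "i * (i * j) = scale a j"
    by (simp add: ii scale_mult_left flip: mult.assoc)
  show iji: "i * j * i = - scale a j"
    by (simp add: mult.assoc ji iij)
  show "i * j * j = scale b i"
    by (simp add: mult.assoc jj scale_mult_right)
  show "j * (i * j) = - scale b i"
    by (metis ji jj mult.assoc mult_minus_left mult.right_neutral scale_mult_right)
  \<comment> \<open>Regrouped as \<open>(i * j * i) * j\<close>, the product reduces to
    \<open>j * j\<close> times a scalar.\<close>
  show "i * j * (i * j) = - scale (a * b) 1"
    by (simp add: iji scale_mult_left jj flip: mult.assoc[of "i * j" i j])
qed

lemma basis_products_char_2:
  assumes "(2::'f) = 0"
  shows "i * i = scale a 1 - i" "j * i = i * j + j" "j * j = scale b 1"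
    "i * (i * j) = scale a j - i * j" "i * j * i = scale a j"
    "i * j * j = scale b i" "j * (i * j) = scale b i + scale b 1"
    "i * j * (i * j) = scale (a * b) 1"
proof -
  show ii: "i * i = scale a 1 - i" and ji: "j * i = i * j + j" and jj: "j * j = scale b 1"
    using char_2[OF assms] j_square by (auto simp: algebra_simps)
  show iij: "i * (i * j) = scale a j - i * j"
    by (simp add: ii scale_mult_left left_diff_distrib flip: mult.assoc)
  show iji: "i * j * i = scale a j"
    by (simp add: mult.assoc ji iij distrib_left)
  show ijj: "i * j * j = scale b i"
    by (simp add: mult.assoc jj scale_mult_right)
  show "j * (i * j) = scale b i + scale b 1"
    by (metis ji ijj jj mult.assoc distrib_right)
  show "i * j * (i * j) = scale (a * b) 1"
    by (simp add: iji scale_mult_left jj flip: mult.assoc[of "i * j" i j])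
qed

section \<open>Canonical conjugation, reduced trace and reduced norm\<close>

lemma basis_expansion:
  obtains x y z w where "q = scale x 1 + scale y i + scale z j + scale w (i * j)"
    and "conjugate q =
      scale x 1 + scale y (if (2::'f) = 0 then i + 1 else - i) - scale z j - scale w (i * j)"
proof
  let ?c = "representation {1, i, j, i * j} q"
  have "q = (\<Sum>x\<in>{1, i, j, i * j}. scale (?c x) x)"
    by (rule sum_representation_eq[OF independent_basis, symmetric]) (simp_all add: span_basis)
  also have "\<dots> = scale (?c 1) 1 + scale (?c i) i + scale (?c j) j + scale (?c (i * j)) (i * j)"
    using distinct_basis by (simp add: add.assoc)
  finally show "q = scale (?c 1) 1 + scale (?c i) i + scale (?c j) j + scale (?c (i * j)) (i * j)" .
  show "conjugate q = scale (?c 1) 1 + scale (?c i) (if (2::'f) = 0 then i + 1 else - i)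
      - scale (?c j) j - scale (?c (i * j)) (i * j)"
    by (simp only: conjugate_def Let_def)
qed

text \<open>Everything rests on \<open>1 + 1 = 0\<close> in the field, carried over by
  \<open>scale\<close>. The second rule cancels neighbours inside a right-nested sum; the third
  removes subtraction, so that sums can be sorted.\<close>

lemma char_2_cancel:
  assumes "(2::'f) = 0"
  shows "x + x = (0::'q)" "x + (x + y) = (y::'q)" "x - y = x + (y::'q)"
proof -
  show dbl: "x + x = 0" for x :: 'q
    using scale_left_distrib[of 1 1 x] assms by simp
  show "x + (x + y) = y"
    by (simp add: dbl flip: add.assoc)
  show "x - y = x + y"
    using dbl[of y] by (simp add: diff_eq_eq add.assoc)
qed

text \<open>The scalar \<open>t\<close> is the reduced trace. It gives access to injectivity at zero
  without first proving that conjugation is linear or an involution.\<close>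

lemma conjugate_eq_trace_minus: "\<exists>t. conjugate q = scale t 1 - q"
proof -
  obtain x y z w where q: "q = scale x 1 + scale y i + scale z j + scale w (i * j)"
    and cq: "conjugate q =
      scale x 1 + scale y (if (2::'f) = 0 then i + 1 else - i) - scale z j - scale w (i * j)"
    by (rule basis_expansion)
  show ?thesis
  proof (cases "(2::'f) = 0")
    case False
    have "conjugate q = scale (x + x) 1 - q"
      unfolding cq unfolding q scale_left_distrib using False by simp
    then show ?thesis by (rule exI)
  next
    case True
    \<comment> \<open>The trace is \<open>y\<close> here: \<open>x\<close> contributes
      \<open>x + x = 0\<close>, and \<open>i\<close> contributes
      \<open>i + (i + 1) = 1\<close>.\<close>
    have "conjugate q = scale y 1 - q"
      unfolding cq unfolding q
      using True by (simp add: char_2_cancel[OF True] scale_right_distrib ac_simps)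
    then show ?thesis by (rule exI)
  qed
qed

lemma conjugate_scale_one: "conjugate (scale t 1) = scale t 1"
proof -
  have "representation {1, i, j, i * j} (scale t 1) = (\<lambda>x. if x = 1 then t else 0)"
    using representation_scale[OF independent_basis, of 1 t]
      representation_basis[OF independent_basis, of 1] span_basis
    by auto
  then show ?thesis
    using distinct_basis by (simp add: conjugate_def Let_def)
qed

lemma conjugate_eq_0_iff: "conjugate q = 0 \<longleftrightarrow> q = 0"
proof
  assume "conjugate q = 0"
  moreover obtain t where "conjugate q = scale t 1 - q"
    using conjugate_eq_trace_minus by blast
  \<comment> \<open>A zero conjugate makes \<open>q\<close> equal to its trace, a scalar;
    conjugation fixes scalars, so \<open>q\<close> is its own conjugate.\<close>
  ultimately show "q = 0"
    using conjugate_scale_one[of t] by simp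
next
  show "q = 0 \<Longrightarrow> conjugate q = 0"
    using conjugate_scale_one[of 0] by simp
qed

text \<open>The witness \<open>r\<close> is the reduced norm form. Expanding by the multiplication
  table, the coefficients of \<open>i\<close>, \<open>j\<close> and \<open>i * j\<close>
  cancel.\<close>

lemma mult_conjugate_in_scalars: "\<exists>r. q * conjugate q = scale r 1"
proof -
  obtain x y z w where q: "q = scale x 1 + scale y i + scale z j + scale w (i * j)"
    and cq: "conjugate q =
      scale x 1 + scale y (if (2::'f) = 0 then i + 1 else - i) - scale z j - scale w (i * j)"
    by (rule basis_expansion)
  show ?thesis
  proof (cases "(2::'f) = 0")
    case False
    have cq': "conjugate q = scale x 1 - scale y i - scale z j - scale w (i * j)"
      unfolding cq using False by simp
    have "q * conjugate q = scale (x * x - a * y * y - b * z * z + a * b * w * w) 1"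
      unfolding cq' unfolding q
      by (simp add: distrib_left distrib_right left_diff_distrib right_diff_distrib
        scale_mult_left scale_mult_right basis_products_char_not_2[OF False]
        scale_left_distrib scale_left_diff_distrib scale_right_distrib scale_right_diff_distrib)
        (simp add: algebra_simps)
    then show ?thesis by (rule exI)
  next
    case True
    have cq': "conjugate q = scale x 1 + scale y i + scale y 1 + scale z j + scale w (i * j)"
      unfolding cq using True by (simp add: char_2_cancel[OF True] scale_right_distrib)
    have "q * conjugate q =
        scale (x * x + x * y + a * y * y + b * z * z + a * b * w * w + b * z * w) 1"
      unfolding cq' unfolding q
      by (simp add: distrib_left distrib_right
        scale_mult_left scale_mult_right basis_products_char_2[OF True] char_2_cancel(3)[OF True]
        scale_left_distrib scale_right_distrib)
        (simp add: ac_simps char_2_cancel(1,2)[OF True])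
    then show ?thesis by (rule exI)
  qed
qed

lemma schur_complement_eq_0_iff:
  assumes "e \<noteq> 0"
  shows "h - g * inverse e * f = 0 \<longleftrightarrow>
    e * conjugate e * h - g * conjugate e * f = 0"
proof -
  obtain r where r: "e * conjugate e = scale r 1"
    using mult_conjugate_in_scalars by blast
  \<comment> \<open>Otherwise \<open>e\<close> or its conjugate would vanish, as there are no zero
    divisors.\<close>
  with assms have "r \<noteq> 0"
    using conjugate_eq_0_iff[of e] by auto
  have "conjugate e = inverse e * (e * conjugate e)"
    using assms by (simp flip: mult.assoc)
  also have "\<dots> = scale r (inverse e)"
    by (simp add: r scale_mult_right)
  finally have "e * conjugate e * h - g * conjugate e * f = scale r (h - g * inverse e * f)"
    using assms by (simp add: r scale_mult_left scale_mult_right scale_right_diff_distrib)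
  with \<open>r \<noteq> 0\<close> show ?thesis by simp
qed

end

section \<open>Null vectors of 2 by 2 matrices over a division ring\<close>

lemma exists_null_vector_2_iff:
  fixes e f g h :: "'a::division_ring"
  shows "(\<exists>w. w \<noteq> 0 \<and> (vector [vector [e, f], vector [g, h]] :: 'a^2^2) *v w = 0) \<longleftrightarrow>
    (e = 0 \<and> f * g = 0) \<or> (e \<noteq> 0 \<and> h - g * inverse e * f = 0)"
    (is "(\<exists>w. ?P w) \<longleftrightarrow> ?R")
proof -
  have P: "?P w \<longleftrightarrow> (w$1 \<noteq> 0 \<or> w$2 \<noteq> 0) \<and> e * w$1 + f * w$2 = 0 \<and> g * w$1 + h * w$2 = 0" for w
    by (auto simp: vec_eq_iff forall_2 matrix_vector_mult_def sum_2)
  have "(\<exists>w. ?P w) \<longleftrightarrow>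
      (\<exists>x y. (x \<noteq> 0 \<or> y \<noteq> 0) \<and> e * x + f * y = 0 \<and> g * x + h * y = 0)"
    unfolding P by (metis vector_2)
  also have "\<dots> \<longleftrightarrow> ?R"
  proof (cases "e = 0")
    case True
    show ?thesis
    proof (cases "f = 0")
      case f: True
      \<comment> \<open>The first row is zero, and a single equation in two unknowns always has a
        nontrivial solution.\<close>
      have "\<exists>x y. (x \<noteq> 0 \<or> y \<noteq> 0) \<and> g * x + h * y = 0"
      proof (cases "g = 0")
        case True
        then show ?thesis by (intro exI[of _ 1] exI[of _ 0]) simp
      next
        case False
        then show ?thesis
          by (intro exI[of _ "- (inverse g * h)"] exI[of _ 1]) (simp flip: mult.assoc)
      qed
      with True f show ?thesis by simp
    next
      case False
      \<comment> \<open>The first row now forces \<open>y = 0\<close>, so a null vector exists iff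
        \<open>g = 0\<close>, with \<open>x = 1\<close> as witness.\<close>
      with True show ?thesis by (auto intro: exI[of _ 1])
    qed
  next
    case False
    have x: "e * x + f * y = 0 \<longleftrightarrow> x = - (inverse e * f * y)" for x y
    proof
      assume "e * x + f * y = 0"
      then have "e * x = - (f * y)" by (simp add: eq_neg_iff_add_eq_0)
      then have "inverse e * (e * x) = - (inverse e * f * y)" by (simp add: mult.assoc)
      then show "x = - (inverse e * f * y)" using False by (simp flip: mult.assoc)
    qed (use False in \<open>simp flip: mult.assoc\<close>)
    have "g * - (inverse e * f * y) + h * y = (h - g * inverse e * f) * y" for y
      by (simp add: algebra_simps)
    then have "(\<exists>x y. (x \<noteq> 0 \<or> y \<noteq> 0) \<and> e * x + f * y = 0 \<and> g * x + h * y = 0) \<longleftrightarrow>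
        (\<exists>y. y \<noteq> 0 \<and> (h - g * inverse e * f) * y = 0)"
      \<comment> \<open>Since \<open>y = 0\<close> would force \<open>x = 0\<close>, nontriviality
        of the pair falls on \<open>y\<close> alone.\<close>
      unfolding x by (metis mult_zero_right neg_0_equal_iff_equal)
    also have "\<dots> \<longleftrightarrow> h - g * inverse e * f = 0"
      by (auto intro: exI[of _ 1])
    finally show ?thesis using False by simp
  qed
  finally show ?thesis .
qed

section \<open>Reduction of the block matrix to a 2 by 2 matrix\<close>

lemma mat_mult_vector: "mat l *v v = l *s v"
  for l :: "'a::semiring_1" and v :: "'a^'n"
  by (simp add: vec_eq_iff matrix_vector_mult_def mat_def if_distrib[of "\<lambda>x. x * _"] cong: if_cong)

lemma vector_4 [simp]:
  "(vector [x, y, z, w] :: 'a::zero^4) $ 1 = x"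
  "(vector [x, y, z, w] :: 'a::zero^4) $ 2 = y"
  "(vector [x, y, z, w] :: 'a::zero^4) $ 3 = z"
  "(vector [x, y, z, w] :: 'a::zero^4) $ 4 = w"
  unfolding vector_def by simp_all

lemma exists_vec_4_blocks:
  fixes P :: "'a::zero^4 \<Rightarrow> bool"
  shows "(\<exists>v. P v) \<longleftrightarrow> (\<exists>(u :: 'a^2) (w :: 'a^2). P (vector [u$1, u$2, w$1, w$2]))"
proof
  assume "\<exists>v. P v"
  then obtain v where v: "P v" ..
  have "v = vector [vector [v$1, v$2]$(1::2), vector [v$1, v$2]$(2::2),
      vector [v$3, v$4]$(1::2), vector [v$3, v$4]$(2::2)]"
    by (simp add: vec_eq_iff forall_4)
  with v show "\<exists>(u :: 'a^2) (w :: 'a^2). P (vector [u$1, u$2, w$1, w$2])"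
    by metis
qed blast

lemma left_eigenvalue_block_matrix_iff:
  fixes A B C D :: "'a::ring_1^2^2"
  shows "left_eigenvalue (block_matrix A B C D) l \<longleftrightarrow>
    (\<exists>u w. (u \<noteq> 0 \<or> w \<noteq> 0) \<and> (A - mat l) *v u + B *v w = 0 \<and> C *v u + (D - mat l) *v w = 0)"
proof -
  \<comment> \<open>These rules carry the subtracted term, the one with \<open>l\<close>, across the
    equation from the positions it can take in an expanded row.\<close>
  have move: "x - y + z = 0 \<longleftrightarrow> x + z = y"
    "z + (x - y) = 0 \<longleftrightarrow> z + x = y"
    "z' + (z + (x - y)) = 0 \<longleftrightarrow> z' + (z + x) = y" for x y z z' :: 'a
    by (simp_all add: diff_add_eq add_diff_eq)
  have "vector [u$1, u$2, w$1, w$2] \<noteq> (0 :: 'a^4) \<and>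
      block_matrix A B C D *v vector [u$1, u$2, w$1, w$2] = l *s vector [u$1, u$2, w$1, w$2] \<longleftrightarrow>
      (u \<noteq> 0 \<or> w \<noteq> 0) \<and> A *v u - l *s u + B *v w = 0 \<and> C *v u + (D *v w - l *s w) = 0"
    for u w :: "'a^2"
    by (simp add: vec_eq_iff forall_2 forall_4 block_matrix_def move
        matrix_vector_mult_def sum_2 sum_4 add.assoc) blast
  then show ?thesis
    by (simp only: left_eigenvalue_def exists_vec_4_blocks matrix_vector_mult_diff_rdistrib
        mat_mult_vector)
qed

text \<open>The second block row determines \<open>u\<close> from \<open>w\<close>, so
  \<open>u\<close> vanishes with \<open>w\<close>. Substituting into the first row and applying
  \<open>- C\<close>, which has trivial kernel, yields the stated matrix.\<close>

lemma exists_null_vector_block_iff: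
  fixes A B C D :: "'a::ring_1^'n^'n"
  assumes "invertible C"
  shows "(\<exists>u w. (u \<noteq> 0 \<or> w \<noteq> 0) \<and> A *v u + B *v w = 0 \<and> C *v u + D *v w = 0) \<longleftrightarrow>
    (\<exists>w. w \<noteq> 0 \<and> (C ** A ** matrix_inv C ** D - C ** B) *v w = 0)"
proof -
  have inv: "C ** matrix_inv C = mat 1" "matrix_inv C ** C = mat 1"
    using assms unfolding invertible_def matrix_inv_def by (metis (mono_tags, lifting) someI_ex)+
  have C_eq_0: "C *v x = 0 \<longleftrightarrow> x = 0" for x
    by (metis inv(2) matrix_vector_mul_assoc matrix_vector_mul_lid matrix_vector_mult_0_right)
  have u: "C *v u + D *v w = 0 \<longleftrightarrow> u = - (matrix_inv C *v (D *v w))" for u w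
  proof -
    have "C *v u + D *v w = C *v (u + matrix_inv C *v (D *v w))"
      by (simp add: matrix_vector_right_distrib matrix_vector_mul_assoc matrix_mul_assoc inv)
    then show ?thesis by (simp add: C_eq_0 eq_neg_iff_add_eq_0)
  qed
  have neg: "X *v (- v) = - (X *v v)" for X :: "'a^'n^'n" and v
    using matrix_vector_mult_diff_distrib[of X 0 v] by simp
  have "(C ** A ** matrix_inv C ** D - C ** B) *v w =
      - (C *v (A *v (- (matrix_inv C *v (D *v w))) + B *v w))" for w
    by (simp add: matrix_vector_right_distrib matrix_vector_mult_diff_rdistrib
        matrix_vector_mult_diff_distrib matrix_vector_mul_assoc matrix_mul_assoc neg)
  then have "(C ** A ** matrix_inv C ** D - C ** B) *v w = 0 \<longleftrightarrow>
      A *v (- (matrix_inv C *v (D *v w))) + B *v w = 0" for w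
    by (simp add: C_eq_0)
  then show ?thesis
    unfolding u by (metis matrix_vector_mult_0_right neg_equal_0_iff_equal)
qed

theorem proposition4p1:
  fixes scale :: "'f::field \<Rightarrow> 'q::division_ring \<Rightarrow> 'q"
    and a b :: 'f and i j :: 'q
    and A B C D :: "'q ^ 2 ^ 2" and M :: "'q ^ 4 ^ 4"
    and e f g h :: "'q \<Rightarrow> 'q" and l :: 'q
  assumes "quaternion_division_algebra scale a b i j"
    and "M = block_matrix A B C D"
    and "invertible C"
    and "\<And>x. C ** (A - mat x) ** matrix_inv C ** (D - mat x) - C ** B =
               vector [vector [e x, f x], vector [g x, h x]]"
  shows "left_eigenvalue M l \<longleftrightarrow>
           (e l = 0 \<and> f l * g l = 0) \<or>
           (e l \<noteq> 0 \<and>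
            e l * quaternion_division_algebra.conjugate scale i j (e l) * h l
              - g l * quaternion_division_algebra.conjugate scale i j (e l) * f l = 0)"
proof -
  interpret quaternion_division_algebra scale a b i j by fact
  have "left_eigenvalue M l \<longleftrightarrow>
      (e l = 0 \<and> f l * g l = 0) \<or> (e l \<noteq> 0 \<and> h l - g l * inverse (e l) * f l = 0)"
    \<comment> \<open>The block elimination is used with \<open>A - mat l\<close> and
      \<open>D - mat l\<close> as diagonal blocks.\<close>
    unfolding assms(2) left_eigenvalue_block_matrix_iff exists_null_vector_block_iff[OF assms(3)]
      assms(4) exists_null_vector_2_iff ..
  then show ?thesis
    using schur_complement_eq_0_iff by blast
qed

end
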